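(* Let $d\geq1$, let $\mathsf{A}\subset M_d(\mathbb{R})$ be a nonempty compact set, and let $\mu$ be a finite Borel measure on $M_d(\mathbb{R})$ with support equal to $\mathsf{A}$. Then \[\lim_{s\to\infty}e^{\mathbf{M}(\mu,s)/s}=\varrho_\infty(\mathsf{A}).\]
   Context: $M_d(\mathbb{R})$ is the space of real $d\times d$ matrices with the operator norm $\|\cdot\|$ induced by the Euclidean norm. For a compact set $\mathsf{A}\subset M_d(\mathbb{R})$, the joint spectral radius is $\varrho_\infty(\mathsf{A}):=\lim_{n\to\infty}\sup\{\|A_1\cdots A_n\|^{1/n}:A_1,\ldots,A_n\in\mathsf{A}\}$ (the limit exists by subadditivity). For a Borel measure $\mu$ on $M_d(\mathbb{R})$ and $n\ge1$, $\mu_n$ is the push-forward of the $n$-fold product $\mu\times\cdots\times\mu$ under $(A_1,\ldots,A_n)\mapsto A_1\cdots A_n$. For $s>0$ with $\int\|A\|^s\,d\mu(A)<\infty$, the norm pressure is $\mathbf{M}(\mu,s):=\lim_{n\to\infty}\frac1n\log\left(\int\|A\|^s\,d\mu_n(A)\right)\in[-\infty,+\infty)$. Conventions: $\log0:=-\infty$, $e^{-\infty}:=0$. *)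

theory Defs
  imports "HOL-Analysis.Analysis"
begin

(* The type class norm on real ^ 'd ^ 'd is the Frobenius norm; the operator norm is needed here. *)
definition op_norm :: "real ^ 'd ^ 'd \<Rightarrow> real" where
  "op_norm A = onorm ((*v) A)"

primrec mat_prod :: "nat \<Rightarrow> (nat \<Rightarrow> real ^ 'd ^ 'd) \<Rightarrow> real ^ 'd ^ 'd" where
  "mat_prod 0 A = mat 1"
| "mat_prod (Suc n) A = mat_prod n A ** A n"

definition joint_spectral_radius :: "(real ^ 'd ^ 'd) set \<Rightarrow> real" where
  "joint_spectral_radius K =
     lim (\<lambda>n. SUP A \<in> {..<n} \<rightarrow>\<^sub>E K. root n (op_norm (mat_prod n A)))"

definition conv_measure :: "(real ^ 'd ^ 'd) measure \<Rightarrow> nat \<Rightarrow> (real ^ 'd ^ 'd) measure" where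
  "conv_measure \<mu> n = distr (\<Pi>\<^sub>M i\<in>{..<n}. \<mu>) borel (mat_prod n)"

definition ext_ln :: "ennreal \<Rightarrow> ereal" where
  "ext_ln x = (if x = 0 then -\<infinity> else if x = \<infinity> then \<infinity> else ereal (ln (enn2real x)))"

fun ext_exp :: "ereal \<Rightarrow> ereal" where
  "ext_exp (ereal r) = ereal (exp r)"
| "ext_exp PInfty = \<infinity>"
| "ext_exp MInfty = 0"

(* The integral is taken in [0, \<infinity>], so that it is not 0 by convention when it diverges;
   it is finite whenever the integral of the s-th power of the norm against \<mu> is. *)
definition norm_pressure :: "(real ^ 'd ^ 'd) measure \<Rightarrow> real \<Rightarrow> ereal" where
  "norm_pressure \<mu> s =
     lim (\<lambda>n. ereal (1 / real n) *
       ext_ln (\<integral>\<^sup>+ A. ennreal (op_norm A powr s) \<partial>conv_measure \<mu> n))"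

definition measure_supp :: "'a::topological_space measure \<Rightarrow> 'a set" where
  "measure_supp \<mu> = {x. \<forall>U. open U \<longrightarrow> x \<in> U \<longrightarrow> 0 < emeasure \<mu> U}"

end

theory Submission
  imports Defs
begin

text \<open>
  Write \<open>m = \<mu>(K)\<close> for the total mass, \<open>R\<^sub>n\<close> for the largest norm of a product of \<open>n\<close> matrices
  from \<open>K\<close>, and \<open>N\<^sub>n(s)\<close> for the integral of \<open>\<parallel>A\<^sub>1 \<dots> A\<^sub>n\<parallel>\<^sup>s\<close>. Both sequences are
  submultiplicative in \<open>n\<close>, so by the multiplicative form of Fekete's lemma
  (\<open>submultiplicative_root_convergent\<close>) their \<open>n\<close>-th roots converge: those of \<open>R\<^sub>n\<close> to the joint
  spectral radius \<open>\<rho>\<close>, and those of \<open>N\<^sub>n(s)\<close> to a number \<open>I(s) \<ge> 0\<close> whose logarithm is the norm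
  pressure. The claim is therefore that \<open>I(s)\<close> to the power \<open>1/s\<close> tends to \<open>\<rho>\<close>.

  The upper bound is trivial: \<open>N\<^sub>n(s) \<le> m\<^sup>n R\<^sub>n\<^sup>s\<close>, so \<open>I(s) \<le> m \<rho>\<^sup>s\<close>, and \<open>m\<close> to the power
  \<open>1/s\<close> tends to \<open>1\<close>.

  The lower bound has to be uniform in \<open>n\<close>, which ordinary continuity of a product of \<open>n\<close>
  factors does not give. The way out is to replace one factor at a time. As a function of one of
  its factors, the norm of a product is a seminorm \<open>p(B) = \<parallel>X B Y\<parallel>\<close>, and seminorms on a
  finite-dimensional space behave uniformly well. Expanding in a basis of the span of \<open>K\<close> taken
  from \<open>K\<close> shows that every seminorm is Lipschitz on that span, with constant \<open>L\<close> times the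
  maximum of \<open>p\<close> on \<open>K\<close>, where \<open>L\<close> depends on \<open>K\<close> only (\<open>seminorm_bound_on_span\<close>).
  Hence \<open>p\<close> is at least \<open>1 - \<delta>\<close> times its maximum on the part of \<open>K\<close> within distance \<open>\<delta>/L\<close> of a
  maximum point. Since \<open>K\<close> is the compact support of \<open>\<mu>\<close>, balls of that radius centred
  in \<open>K\<close> have measure at least some \<open>c > 0\<close>. So
  \<open>p(A)\<^sup>s\<close>, for any \<open>A \<in> K\<close>, is at most \<open>D = 1 / (c (1 - \<delta>)\<^sup>s)\<close> times the integral of \<open>p\<^sup>s\<close>,
  where \<open>c\<close> depends neither on \<open>p\<close> nor on \<open>s\<close> (\<open>seminorm_integral_lower_bound\<close>).
  Replacing the factors of \<open>A\<^sub>1 \<dots> A\<^sub>n\<close> by integrals one after the other costs \<open>D\<^sup>n\<close>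
  (\<open>norm_moment_lower\<close>), so \<open>R\<^sub>n\<^sup>s \<le> D\<^sup>n N\<^sub>n(s)\<close> and \<open>I(s) \<ge> c ((1 - \<delta>) \<rho>)\<^sup>s\<close>. Taking \<open>s\<close>-th
  roots, letting \<open>s\<close> tend to infinity and then \<open>\<delta>\<close> to \<open>0\<close> finishes the proof.
\<close>

section \<open>Seminorms on finite-dimensional spaces\<close>

definition seminorm :: "('a::real_vector \<Rightarrow> real) \<Rightarrow> bool" where
  "seminorm p \<longleftrightarrow> (\<forall>x y. p (x + y) \<le> p x + p y) \<and> (\<forall>c x. p (c *\<^sub>R x) = \<bar>c\<bar> * p x)"

lemma seminorm_zero: "seminorm p \<Longrightarrow> p 0 = 0"
  unfolding seminorm_def by (metis abs_zero mult_zero_left scaleR_zero_left)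

lemma seminorm_minus: "seminorm p \<Longrightarrow> p (- x) = p x"
  unfolding seminorm_def by (metis abs_minus_cancel abs_one mult_1 scaleR_minus1_left)

lemma seminorm_nonneg:
  assumes "seminorm p"
  shows "0 \<le> p x"
proof -
  have "p (x + - x) \<le> p x + p (- x)"
    using assms unfolding seminorm_def by blast
  then show ?thesis
    using seminorm_zero[OF assms] seminorm_minus[OF assms, of x] by simp
qed

lemma seminorm_sum:
  assumes "seminorm p"
  shows "p (\<Sum>i\<in>I. f i) \<le> (\<Sum>i\<in>I. p (f i))"
proof (induction I rule: infinite_finite_induct)
  case (insert i I)
  then show ?case
    using assms unfolding seminorm_def
    by (smt (verit) sum.insert)
qed (simp_all add: seminorm_zero[OF assms])

lemma seminorm_diff_le:
  assumes "seminorm p"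
  shows "p x - p y \<le> p (x - y)"
proof -
  have "p ((x - y) + y) \<le> p (x - y) + p y"
    using assms unfolding seminorm_def by blast
  then show ?thesis by simp
qed

lemma continuous_on_seminorm:
  fixes p :: "'a::euclidean_space \<Rightarrow> real"
  assumes "seminorm p"
  shows "continuous_on S p"
proof -
  have "convex_on UNIV p"
  proof (rule convex_onI)
    fix t x y assume t: "(0::real) < t" "t < 1"
    have "p ((1 - t) *\<^sub>R x + t *\<^sub>R y) \<le> p ((1 - t) *\<^sub>R x) + p (t *\<^sub>R y)"
      using assms unfolding seminorm_def by blast
    also have "\<dots> = (1 - t) * p x + t * p y"
      using assms t unfolding seminorm_def by simp
    finally show "p ((1 - t) *\<^sub>R x + t *\<^sub>R y) \<le> (1 - t) * p x + t * p y" .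
  qed simp
  then have "continuous_on UNIV p"
    by (intro convex_on_continuous) auto
  then show ?thesis
    by (rule continuous_on_subset) simp
qed

lemma borel_measurable_seminorm:
  fixes p :: "'a::euclidean_space \<Rightarrow> real"
  shows "seminorm p \<Longrightarrow> p \<in> borel_measurable borel"
  by (intro borel_measurable_continuous_onI continuous_on_seminorm)

text \<open>
  The point is the order of the quantifiers: \<open>L\<close> depends on \<open>K\<close> but not on the seminorm. Writing
  \<open>v\<close> in a basis taken from \<open>K\<close> bounds \<open>p v\<close> by the sum of the absolute values of the
  coordinates, each of which is a fixed linear functional of \<open>v\<close>, times the bound on \<open>p\<close> over \<open>K\<close>.
\<close>
lemma seminorm_bound_on_span:
  fixes K :: "'a::euclidean_space set"
  obtains L where "L > 0"
    "\<And>p S v. seminorm p \<Longrightarrow> (\<And>b. b \<in> K \<Longrightarrow> p b \<le> S) \<Longrightarrow> v \<in> span K \<Longrightarrow> p v \<le> L * norm v * S"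
proof -
  obtain B where B: "B \<subseteq> K" "independent B" "K \<subseteq> span B"
    by (rule maximal_independent_subset)
  have finB: "finite B"
    using B(2) by (rule independent_imp_finite)
  \<comment> \<open>The coordinate functionals of the basis, extended to the whole space.\<close>
  have "\<exists>g. linear g \<and> (\<forall>x\<in>B. g x = (if x = b then 1 else 0::real))" for b
    by (rule linear_independent_extend[OF B(2)])
  then obtain g where lin: "\<And>b. linear (g b)"
    and g: "\<And>b x. x \<in> B \<Longrightarrow> g b x = (if x = b then 1 else 0::real)"
    by metis
  have repr: "(\<Sum>b\<in>B. g b v *\<^sub>R b) = v" if "v \<in> span K" for v
  proof -
    have v: "v \<in> span B"
      using that B(3) by (metis span_mono span_span subsetD)
    show ?thesis
    proof (rule linear_eq_on_span[where f = "\<lambda>v. \<Sum>b\<in>B. g b v *\<^sub>R b" and g = "\<lambda>v. v", OF _ _ _ v])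
      show "linear (\<lambda>v. \<Sum>b\<in>B. g b v *\<^sub>R b)"
        using lin by (intro linear_compose_sum ballI) (simp add: linear_iff scaleR_add_left)
      show "linear (\<lambda>v::'a. v)"
        by (rule linear_ident)
      show "(\<Sum>b\<in>B. g b x *\<^sub>R b) = x" if "x \<in> B" for x
        using that finB by (simp add: g if_distrib[of "\<lambda>c. c *\<^sub>R _"] sum.delta cong: if_cong)
    qed
  qed
  \<comment> \<open>The summand 1 only makes the constant positive when the basis is empty.\<close>
  define L where "L = 1 + (\<Sum>b\<in>B. onorm (g b))"
  have bl: "bounded_linear (g b)" for b
    using lin linear_conv_bounded_linear by blast
  show thesis
  proof (rule that)
    show "L > 0"
      unfolding L_def by (intro add_pos_nonneg sum_nonneg onorm_pos_le bl) simp
    fix p :: "'a \<Rightarrow> real" and S v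
    assume p: "seminorm p" and S: "\<And>b. b \<in> K \<Longrightarrow> p b \<le> S" and v: "v \<in> span K"
    show "p v \<le> L * norm v * S"
    proof (cases "K = {}")
      case True
      then have "v = 0" using v by simp
      then show ?thesis using seminorm_zero[OF p] by simp
    next
      case False
      then have S0: "0 \<le> S"
        using S seminorm_nonneg[OF p] order_trans by blast
      have "p v = p (\<Sum>b\<in>B. g b v *\<^sub>R b)"
        using repr[OF v] by simp
      also have "\<dots> \<le> (\<Sum>b\<in>B. p (g b v *\<^sub>R b))"
        by (rule seminorm_sum[OF p])
      also have "\<dots> = (\<Sum>b\<in>B. \<bar>g b v\<bar> * p b)"
        using p unfolding seminorm_def by simp
      also have "\<dots> \<le> (\<Sum>b\<in>B. (onorm (g b) * norm v) * S)"
      proof (intro sum_mono mult_mono)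
        fix b assume "b \<in> B"
        then show "p b \<le> S" using S B(1) by blast
        show "\<bar>g b v\<bar> \<le> onorm (g b) * norm v"
          using onorm[OF bl, of b v] by simp
        show "0 \<le> onorm (g b) * norm v"
          by (intro mult_nonneg_nonneg onorm_pos_le bl) simp
      qed (use seminorm_nonneg[OF p] in auto)
      also have "\<dots> = (\<Sum>b\<in>B. onorm (g b)) * norm v * S"
        by (simp add: sum_distrib_right)
      also have "\<dots> \<le> L * norm v * S"
        unfolding L_def using S0 by (intro mult_right_mono) auto
      finally show ?thesis .
    qed
  qed
qed

section \<open>Measures and their supports\<close>

text \<open>
  The complement of the support is the union of all open null sets, and by the Lindelof property
  countably many of them suffice to cover it.
\<close>
lemma AE_in_measure_supp:
  fixes M :: "'a::second_countable_topology measure"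
  assumes sets: "sets M = sets borel"
  shows "AE x in M. x \<in> measure_supp M"
proof -
  define \<U> where "\<U> = {U. open U \<and> emeasure M U = 0}"
  obtain \<F> where \<F>: "\<F> \<subseteq> \<U>" "countable \<F>" "\<Union>\<F> = \<Union>\<U>"
    by (rule Lindelof[of \<U>]) (auto simp: \<U>_def)
  have "(\<Union>U\<in>\<F>. U) \<in> null_sets M"
    using \<F> by (intro null_sets_UN') (auto simp: \<U>_def null_sets_def sets)
  moreover have "{x \<in> space M. x \<notin> measure_supp M} \<subseteq> (\<Union>U\<in>\<F>. U)"
    using \<F>(3) unfolding \<U>_def measure_supp_def by (auto simp: not_gr_zero)
  ultimately show ?thesis
    by (rule AE_I')
qed

text \<open>
  Finitely many balls of radius \<open>e/2\<close> with centres in \<open>K\<close> cover \<open>K\<close>, and every ball of radius \<open>e\<close>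
  centred in \<open>K\<close> contains one of them.
\<close>
lemma ball_measure_uniform_lower_bound:
  fixes M :: "'a::metric_space measure"
  assumes sets: "sets M = sets borel" and fin: "finite_measure M"
    and cpt: "compact K" and K: "K \<subseteq> measure_supp M" and e: "e > 0"
  obtains c where "c > 0" "\<And>x. x \<in> K \<Longrightarrow> c \<le> measure M (ball x e)"
proof -
  interpret finite_measure M by (rule fin)
  obtain F where F: "finite F" "F \<subseteq> K" "K \<subseteq> (\<Union>x\<in>F. ball x (e/2))"
    using compactE_image[OF cpt, of K "\<lambda>x. ball x (e/2)"] e
    by (metis UN_I centre_in_ball half_gt_zero open_ball subsetI)
  define c where "c = Min (insert 1 ((\<lambda>x. measure M (ball x (e/2))) ` F))"
  have pos: "measure M (ball x (e/2)) > 0" if "x \<in> F" for x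
  proof -
    have "0 < emeasure M (ball x (e/2))"
      using that F(2) K e unfolding measure_supp_def by (force simp: subset_iff)
    then show ?thesis
      by (simp add: emeasure_eq_measure ennreal_less_zero_iff)
  qed
  show thesis
  proof (rule that)
    show "c > 0"
      unfolding c_def using F(1) pos by (subst Min_gr_iff) auto
    fix x assume "x \<in> K"
    then obtain y where y: "y \<in> F" "x \<in> ball y (e/2)"
      using F(3) by blast
    have "c \<le> measure M (ball y (e/2))"
      unfolding c_def using F(1) y(1) by (intro Min_le) auto
    also have "\<dots> \<le> measure M (ball x e)"
    proof (rule finite_measure_mono)
      show "ball y (e/2) \<subseteq> ball x e"
      proof
        fix z assume "z \<in> ball y (e/2)"
        then show "z \<in> ball x e"
          using y(2) dist_triangle[of x z y] by (simp add: dist_commute)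
      qed
    qed (simp add: sets)
    finally show "c \<le> measure M (ball x e)" .
  qed
qed

text \<open>
  This is the heart of the argument: up to the factor \<open>1 - \<delta>\<close> and a constant \<open>c\<close> that is the same
  for all seminorms and all exponents, the maximum of a seminorm on the support is controlled by
  its \<open>s\<close>-th mean. The reason is that a seminorm cannot drop quickly near its maximum point \<open>A0\<close>:
  differences of points of \<open>K\<close> lie in the span of \<open>K\<close>, where its slope is at most \<open>L * p A0\<close>.
\<close>
lemma seminorm_integral_lower_bound:
  fixes M :: "'a::euclidean_space measure"
  assumes sets: "sets M = sets borel" and fin: "finite_measure M"
    and supp: "measure_supp M = K" and cpt: "compact K"
    and \<delta>: "0 < \<delta>" "\<delta> < 1"
  obtains c where "c > 0"
    "\<And>p s A. seminorm p \<Longrightarrow> s > 0 \<Longrightarrow> A \<in> K \<Longrightarrow>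
       ennreal (c * (1 - \<delta>) powr s) * ennreal (p A powr s) \<le> (\<integral>\<^sup>+B. ennreal (p B powr s) \<partial>M)"
proof -
  interpret finite_measure M by (rule fin)
  obtain L where L: "L > 0"
    "\<And>p S v. seminorm p \<Longrightarrow> (\<And>b. b \<in> K \<Longrightarrow> p b \<le> S) \<Longrightarrow> v \<in> span K \<Longrightarrow> p v \<le> L * norm v * S"
    using seminorm_bound_on_span[of K] by metis
  define e where "e = \<delta> / L"
  have e: "e > 0" using \<delta> L(1) by (simp add: e_def)
  obtain c where c: "c > 0" "\<And>x. x \<in> K \<Longrightarrow> c \<le> measure M (ball x e)"
    using ball_measure_uniform_lower_bound[OF sets fin cpt _ e] supp by blast
  show thesis
  proof (rule that[OF c(1)])
    fix p :: "'a \<Rightarrow> real" and s :: real and A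
    assume p: "seminorm p" and s: "s > 0" and A: "A \<in> K"
    obtain A0 where A0: "A0 \<in> K" "\<And>B. B \<in> K \<Longrightarrow> p B \<le> p A0"
      using continuous_attains_sup[OF cpt _ continuous_on_seminorm[OF p]] A by blast
    have near: "(1 - \<delta>) * p A0 \<le> p B" if "B \<in> K" "B \<in> ball A0 e" for B
    proof -
      have "p A0 - p B \<le> p (A0 - B)"
        by (rule seminorm_diff_le[OF p])
      also have "\<dots> \<le> L * norm (A0 - B) * p A0"
        by (intro L(2) p A0 span_diff span_base that(1))
      also have "\<dots> \<le> L * e * p A0"
        using that(2) L(1) seminorm_nonneg[OF p]
        by (intro mult_right_mono mult_left_mono) (auto simp: dist_norm)
      also have "\<dots> = \<delta> * p A0"
        using L(1) by (simp add: e_def)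
      finally show ?thesis by (simp add: algebra_simps)
    qed
    have "(c * (1 - \<delta>) powr s) * p A powr s \<le> ((1 - \<delta>) * p A0) powr s * measure M (ball A0 e)"
    proof -
      have "(c * (1 - \<delta>) powr s) * p A powr s = ((1 - \<delta>) * p A) powr s * c"
        using \<delta> seminorm_nonneg[OF p] by (simp add: powr_mult)
      also have "\<dots> \<le> ((1 - \<delta>) * p A0) powr s * measure M (ball A0 e)"
        using \<delta> seminorm_nonneg[OF p] s c A0 A
        by (intro mult_mono powr_mono2) (auto intro: mult_left_mono)
      finally show ?thesis .
    qed
    then have "ennreal (c * (1 - \<delta>) powr s) * ennreal (p A powr s)
        \<le> ennreal (((1 - \<delta>) * p A0) powr s) * emeasure M (ball A0 e)"
      using c(1) \<delta> by (simp add: emeasure_eq_measure ennreal_mult[symmetric] ennreal_leI)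
    also have "\<dots> = (\<integral>\<^sup>+B. ennreal (((1 - \<delta>) * p A0) powr s) * indicator (ball A0 e) B \<partial>M)"
      by (simp add: nn_integral_cmult_indicator sets)
    also have "\<dots> \<le> (\<integral>\<^sup>+B. ennreal (p B powr s) \<partial>M)"
    proof (rule nn_integral_mono_AE)
      show "AE B in M. ennreal (((1 - \<delta>) * p A0) powr s) * indicator (ball A0 e) B
          \<le> ennreal (p B powr s)"
        using AE_in_measure_supp[OF sets]
      proof eventually_elim
        case (elim B)
        then show ?case
          using near[of B] supp s \<delta> seminorm_nonneg[OF p]
          by (auto simp: indicator_def intro!: ennreal_leI powr_mono2 mult_nonneg_nonneg)
      qed
    qed
    finally show "ennreal (c * (1 - \<delta>) powr s) * ennreal (p A powr s)
        \<le> (\<integral>\<^sup>+B. ennreal (p B powr s) \<partial>M)" .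
  qed
qed

section \<open>Submultiplicative sequences\<close>

text \<open>
  Fekete's lemma in multiplicative form, which unlike the additive one for \<open>ln (a n)\<close> also covers
  sequences with vanishing terms and the limit \<open>0\<close>. The limit is the infimum of the roots: if
  \<open>a m \<le> c ^ m\<close> for one \<open>m\<close>, then division with remainder by \<open>m\<close> gives \<open>a n \<le> C * c ^ n\<close> for all \<open>n\<close>.
\<close>
lemma submultiplicative_root_convergent:
  fixes a :: "nat \<Rightarrow> real"
  assumes nonneg: "\<And>n. 0 \<le> a n" and sub: "\<And>m n. a (m + n) \<le> a m * a n"
  shows "\<exists>l\<ge>0. (\<lambda>n. root n (a n)) \<longlonglongrightarrow> l"
proof -
  define l where "l = (INF n\<in>{1..}. root n (a n))"
  have rnn: "0 \<le> root n (a n)" for n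
    by (metis nonneg real_root_ge_zero)
  have bdd: "bdd_below ((\<lambda>n. root n (a n)) ` {1..})"
    using rnn by (intro bdd_belowI[of _ 0]) auto
  have l0: "0 \<le> l"
    unfolding l_def by (intro cINF_greatest) (auto simp: rnn)
  have "(\<lambda>n. root n (a n)) \<longlonglongrightarrow> l"
  proof (rule order_tendstoI)
    fix b assume b: "b < l"
    show "\<forall>\<^sub>F n in sequentially. b < root n (a n)"
      using eventually_ge_at_top[of 1]
    proof eventually_elim
      case (elim n)
      then have "l \<le> root n (a n)"
        unfolding l_def by (intro cINF_lower bdd) auto
      then show ?case using b by simp
    qed
  next
    fix b assume b: "l < b"
    define c where "c = (l + b) / 2"
    have c: "l < c" "c < b" "0 < c" using b l0 by (auto simp: c_def)
    obtain m where m: "m \<ge> 1" "root m (a m) < c"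
      using c(1) unfolding l_def by (subst (asm) cINF_less_iff[OF _ bdd]) auto
    have am: "a m \<le> c ^ m"
    proof -
      have "a m = root m (a m) ^ m"
        using m(1) nonneg by simp
      also have "\<dots> \<le> c ^ m"
        using m(2) rnn by (intro power_mono) auto
      finally show ?thesis .
    qed
    have iter: "a (q * m + r) \<le> c ^ (q * m) * a r" for q r
    proof (induction q)
      case (Suc q)
      have "a (Suc q * m + r) = a (m + (q * m + r))"
        by (simp add: algebra_simps)
      also have "\<dots> \<le> a m * a (q * m + r)" by (rule sub)
      also have "\<dots> \<le> c ^ m * (c ^ (q * m) * a r)"
        using am Suc nonneg c by (intro mult_mono) auto
      finally show ?case by (simp add: power_add algebra_simps)
    qed simp
    \<comment> \<open>A bound for the contribution of all possible remainders.\<close>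
    define C where "C = 1 + (\<Sum>r<m. a r / c ^ r)"
    have C: "C > 0"
      unfolding C_def using nonneg c by (intro add_pos_nonneg sum_nonneg) auto
    have bound: "a n \<le> C * c ^ n" for n
    proof -
      define q r where "q = n div m" and "r = n mod m"
      have n: "n = q * m + r" and r: "r < m"
        using m(1) by (auto simp: q_def r_def)
      have "a n \<le> c ^ (q * m) * a r"
        using iter[of q r] n by simp
      also have "\<dots> = c ^ n * (a r / c ^ r)"
        using c by (simp add: n power_add)
      also have "\<dots> \<le> c ^ n * C"
      proof (intro mult_left_mono)
        have "a r / c ^ r \<le> (\<Sum>r<m. a r / c ^ r)"
          using r nonneg c by (intro member_le_sum) auto
        then show "a r / c ^ r \<le> C" by (simp add: C_def)
      qed (use c in auto)
      finally show ?thesis by (simp add: mult.commute)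
    qed
    have "(\<lambda>n. root n C * c) \<longlonglongrightarrow> 1 * c"
      by (intro tendsto_intros LIMSEQ_root_const C)
    then have "\<forall>\<^sub>F n in sequentially. root n C * c < b"
      using c by (intro order_tendstoD) auto
    then show "\<forall>\<^sub>F n in sequentially. root n (a n) < b"
      using eventually_ge_at_top[of 1]
    proof eventually_elim
      case (elim n)
      have "root n (a n) \<le> root n (C * c ^ n)"
        using elim bound by simp
      also have "\<dots> = root n C * c"
        using elim c by (simp add: real_root_mult real_root_power_cancel)
      finally show ?case using elim by simp
    qed
  qed
  then show ?thesis using l0 by blast
qed

section \<open>Operator norms of matrix products\<close>

lemma op_norm_nonneg: "0 \<le> op_norm A"
  unfolding op_norm_def by (rule onorm_pos_le) simp

lemma op_norm_mult: "op_norm (A ** B) \<le> op_norm A * op_norm B"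
proof -
  have "(*v) (A ** B) = (*v) A \<circ> (*v) B"
    by (simp add: fun_eq_iff matrix_vector_mul_assoc)
  then show ?thesis
    unfolding op_norm_def by (metis onorm_compose matrix_vector_mul_bounded_linear)
qed

lemma op_norm_mat_1_le: "op_norm (mat 1 :: real ^ 'd ^ 'd) \<le> 1"
  unfolding op_norm_def by (rule onorm_bound) auto

lemma seminorm_op_norm: "seminorm op_norm"
  unfolding seminorm_def op_norm_def
proof (intro conjI allI)
  fix A B :: "real ^ 'd ^ 'd" and c :: real
  show "onorm ((*v) (A + B)) \<le> onorm ((*v) A) + onorm ((*v) B)"
    using onorm_triangle[of "(*v) A" "(*v) B"]
    by (simp add: matrix_vector_mult_add_rdistrib[abs_def])
  show "onorm ((*v) (c *\<^sub>R A)) = \<bar>c\<bar> * onorm ((*v) A)"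
    using onorm_scaleR[of "(*v) A" c] by (simp add: scaleR_matrix_vector_assoc)
qed

text \<open>
  Through this fact the one-factor estimate for seminorms applies to each factor of a product.
\<close>
lemma seminorm_op_norm_sandwich:
  fixes X Y :: "real ^ 'd ^ 'd"
  shows "seminorm (\<lambda>B. op_norm (X ** B ** Y))"
proof -
  have add: "(A + B) ** Y = A ** Y + B ** Y" for A B :: "real ^ 'd ^ 'd"
    by (simp add: matrix_matrix_mult_def vec_eq_iff sum.distrib distrib_right)
  have "seminorm (op_norm :: real ^ 'd ^ 'd \<Rightarrow> real)"
    by (rule seminorm_op_norm)
  then show ?thesis
    unfolding seminorm_def
    by (simp add: matrix_add_ldistrib matrix_scalar_ac scalar_matrix_assoc[symmetric] add)
qed

lemma measurable_op_norm [measurable]: "op_norm \<in> borel_measurable borel"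
  by (rule borel_measurable_seminorm[OF seminorm_op_norm])

lemma measurable_matrix_mult [measurable (raw)]:
  fixes f g :: "'a \<Rightarrow> real ^ 'd ^ 'd"
  assumes "f \<in> borel_measurable M" "g \<in> borel_measurable M"
  shows "(\<lambda>x. f x ** g x) \<in> borel_measurable M"
  using assms
proof (rule borel_measurable_continuous_Pair)
  show "continuous_on UNIV (\<lambda>x::(real ^ 'd ^ 'd) \<times> (real ^ 'd ^ 'd). fst x ** snd x)"
    unfolding matrix_matrix_mult_def
    by (intro continuous_intros)
qed

lemma mat_prod_cong:
  "(\<And>i. i < n \<Longrightarrow> A i = B i) \<Longrightarrow> mat_prod n A = mat_prod n B"
  by (induction n) auto

lemma mat_prod_add: "mat_prod (m + n) A = mat_prod m A ** mat_prod n (\<lambda>i. A (m + i))"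
  by (induction n) (simp_all add: matrix_mul_assoc)

lemma measurable_mat_prod:
  assumes "sets \<mu> = sets borel" "{..<n} \<subseteq> I"
  shows "mat_prod n \<in> borel_measurable (\<Pi>\<^sub>M i\<in>I. \<mu>)"
  using assms(2)
proof (induction n)
  case 0
  have "mat_prod 0 = (\<lambda>A. mat 1)" by (simp add: fun_eq_iff)
  then show ?case by simp
next
  case (Suc n)
  have "(\<lambda>A. A n) \<in> measurable (\<Pi>\<^sub>M i\<in>I. \<mu>) \<mu>"
    using Suc.prems by (intro measurable_component_singleton) auto
  then have "(\<lambda>A. A n) \<in> borel_measurable (\<Pi>\<^sub>M i\<in>I. \<mu>)"
    using measurable_cong_sets[OF refl assms(1)] by blast
  then have "(\<lambda>A. mat_prod n A ** A n) \<in> borel_measurable (\<Pi>\<^sub>M i\<in>I. \<mu>)"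
    using Suc.prems by (intro measurable_matrix_mult Suc.IH) auto
  moreover have "mat_prod (Suc n) = (\<lambda>A. mat_prod n A ** A n)"
    by (simp add: fun_eq_iff)
  ultimately show ?case by simp
qed

section \<open>The joint spectral radius as a growth rate\<close>

definition max_prod_norm :: "(real ^ 'd ^ 'd) set \<Rightarrow> nat \<Rightarrow> real" where
  "max_prod_norm K n = (SUP A \<in> {..<n} \<rightarrow>\<^sub>E K. op_norm (mat_prod n A))"

context
  fixes K :: "(real ^ 'd ^ 'd) set"
  assumes K: "K \<noteq> {}" "compact K"
begin

lemma op_norm_mat_prod_bdd: "bdd_above ((\<lambda>A. op_norm (mat_prod n A)) ` ({..<n} \<rightarrow>\<^sub>E K))"
proof -
  obtain b where b: "\<And>B. B \<in> K \<Longrightarrow> op_norm B \<le> b"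
    using continuous_attains_sup[OF K(2) K(1) continuous_on_seminorm[OF seminorm_op_norm]] by blast
  have b0: "0 \<le> b"
    using K(1) b op_norm_nonneg order_trans by blast
  have "op_norm (mat_prod n A) \<le> b ^ n" if "\<And>i. i < n \<Longrightarrow> A i \<in> K" for A
    using that
  proof (induction n)
    case (Suc n)
    have "op_norm (mat_prod (Suc n) A) \<le> op_norm (mat_prod n A) * op_norm (A n)"
      using op_norm_mult by simp
    also have "\<dots> \<le> b ^ n * b"
      using Suc b b0 by (intro mult_mono op_norm_nonneg) auto
    finally show ?case by (simp add: mult.commute)
  qed (use op_norm_mat_1_le in simp)
  then show ?thesis
    by (intro bdd_aboveI2[of _ _ "b ^ n"]) (auto simp: PiE_iff)
qed

lemma op_norm_mat_prod_le_max:
  assumes "\<And>i. i < n \<Longrightarrow> A i \<in> K"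
  shows "op_norm (mat_prod n A) \<le> max_prod_norm K n"
proof -
  have "op_norm (mat_prod n (restrict A {..<n})) \<le> max_prod_norm K n"
    unfolding max_prod_norm_def using assms
    by (intro cSUP_upper op_norm_mat_prod_bdd) (auto simp only: restrict_PiE_iff lessThan_iff)
  moreover have "mat_prod n (restrict A {..<n}) = mat_prod n A"
    by (rule mat_prod_cong) simp
  ultimately show ?thesis by simp
qed

lemma max_prod_norm_le:
  assumes "\<And>A. (\<And>i. i < n \<Longrightarrow> A i \<in> K) \<Longrightarrow> op_norm (mat_prod n A) \<le> c"
  shows "max_prod_norm K n \<le> c"
  unfolding max_prod_norm_def using K(1) assms
  by (intro cSUP_least) (auto simp: PiE_eq_empty_iff PiE_iff)

lemma max_prod_norm_nonneg: "0 \<le> max_prod_norm K n"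
proof -
  obtain B where "B \<in> K" using K by blast
  then have "op_norm (mat_prod n (\<lambda>_. B)) \<le> max_prod_norm K n"
    by (intro op_norm_mat_prod_le_max)
  then show ?thesis using op_norm_nonneg order_trans by blast
qed

lemma max_prod_norm_submultiplicative:
  "max_prod_norm K (m + n) \<le> max_prod_norm K m * max_prod_norm K n"
proof (rule max_prod_norm_le)
  fix A :: "nat \<Rightarrow> real ^ 'd ^ 'd" assume A: "\<And>i. i < m + n \<Longrightarrow> A i \<in> K"
  have "op_norm (mat_prod (m + n) A) \<le> op_norm (mat_prod m A) * op_norm (mat_prod n (\<lambda>i. A (m + i)))"
    unfolding mat_prod_add by (rule op_norm_mult)
  also have "\<dots> \<le> max_prod_norm K m * max_prod_norm K n"
    using A by (intro mult_mono op_norm_mat_prod_le_max op_norm_nonneg max_prod_norm_nonneg) auto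
  finally show "op_norm (mat_prod (m + n) A) \<le> max_prod_norm K m * max_prod_norm K n" .
qed

text \<open>
  The root may be pulled out of the supremum because it is increasing, so that the convergence of
  submultiplicative sequences applies to the suprema of the norms themselves.
\<close>
lemma max_prod_norm_root_tendsto:
  "(\<lambda>n. root n (max_prod_norm K n)) \<longlonglongrightarrow> joint_spectral_radius K"
  and joint_spectral_radius_nonneg: "0 \<le> joint_spectral_radius K"
proof -
  obtain l where l: "l \<ge> 0" "(\<lambda>n. root n (max_prod_norm K n)) \<longlonglongrightarrow> l"
    using submultiplicative_root_convergent[of "max_prod_norm K"]
      max_prod_norm_nonneg max_prod_norm_submultiplicative by blast
  have root_SUP: "(SUP A \<in> {..<n} \<rightarrow>\<^sub>E K. root n (op_norm (mat_prod n A))) = root n (max_prod_norm K n)"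
    if n: "n > 0" for n
  proof (rule antisym)
    have ne: "{..<n} \<rightarrow>\<^sub>E K \<noteq> {}"
      using K(1) by (simp add: PiE_eq_empty_iff)
    have le: "root n (op_norm (mat_prod n A)) \<le> root n (max_prod_norm K n)"
      if "A \<in> {..<n} \<rightarrow>\<^sub>E K" for A
      using that n by (auto intro!: op_norm_mat_prod_le_max)
    then have bdd: "bdd_above ((\<lambda>A. root n (op_norm (mat_prod n A))) ` ({..<n} \<rightarrow>\<^sub>E K))"
      by (rule bdd_aboveI2)
    show "(SUP A \<in> {..<n} \<rightarrow>\<^sub>E K. root n (op_norm (mat_prod n A))) \<le> root n (max_prod_norm K n)"
      by (rule cSUP_least[OF ne le])
    define S where "S = (SUP A \<in> {..<n} \<rightarrow>\<^sub>E K. root n (op_norm (mat_prod n A)))"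
    have S: "root n (op_norm (mat_prod n A)) \<le> S" if "A \<in> {..<n} \<rightarrow>\<^sub>E K" for A
      unfolding S_def by (rule cSUP_upper[OF that bdd])
    have S0: "0 \<le> S"
      using S ne real_root_ge_zero[OF op_norm_nonneg] order_trans by blast
    have "max_prod_norm K n \<le> S ^ n"
      unfolding max_prod_norm_def
    proof (rule cSUP_least[OF ne])
      fix A assume "A \<in> {..<n} \<rightarrow>\<^sub>E K"
      then have "root n (op_norm (mat_prod n A)) ^ n \<le> S ^ n"
        by (intro power_mono S real_root_ge_zero op_norm_nonneg)
      then show "op_norm (mat_prod n A) \<le> S ^ n"
        using n by (simp add: op_norm_nonneg)
    qed
    then have "root n (max_prod_norm K n) \<le> root n (S ^ n)"
      using n by simp
    then show "root n (max_prod_norm K n) \<le> S"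
      using n S0 by (simp add: real_root_power_cancel)
  qed
  have "(\<lambda>n. SUP A \<in> {..<n} \<rightarrow>\<^sub>E K. root n (op_norm (mat_prod n A))) \<longlonglongrightarrow> l"
    using l(2)
    by (rule Lim_transform_eventually)
       (use eventually_gt_at_top[of 0] in eventually_elim, simp add: root_SUP)
  then have "joint_spectral_radius K = l"
    unfolding joint_spectral_radius_def by (rule limI)
  then show "(\<lambda>n. root n (max_prod_norm K n)) \<longlonglongrightarrow> joint_spectral_radius K"
    and "0 \<le> joint_spectral_radius K"
    using l by simp_all
qed

end

section \<open>Moments of the norm of random products\<close>

text \<open>
  The integral of \<open>\<parallel>A\<^sub>1 \<dots> A\<^sub>n Y\<parallel>\<^sup>s\<close>. The extra right factor \<open>Y\<close> makes the moments satisfy a recursion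
  in \<open>n\<close> (\<open>norm_moment_Suc\<close> below), from which all their properties follow by induction with \<open>Y\<close>
  arbitrary; only \<open>Y = 1\<close> matters in the end.
\<close>
definition norm_moment ::
  "(real ^ 'd ^ 'd) measure \<Rightarrow> real \<Rightarrow> nat \<Rightarrow> real ^ 'd ^ 'd \<Rightarrow> ennreal" where
  "norm_moment \<mu> s n Y = (\<integral>\<^sup>+ A. ennreal (op_norm (mat_prod n A ** Y) powr s) \<partial>(\<Pi>\<^sub>M i\<in>{..<n}. \<mu>))"

context
  fixes \<mu> :: "(real ^ 'd ^ 'd) measure"
  assumes sets_\<mu>: "sets \<mu> = sets borel" and fin_\<mu>: "finite_measure \<mu>"
begin

lemma nn_integral_conv_measure:
  "(\<integral>\<^sup>+ A. ennreal (op_norm A powr s) \<partial>conv_measure \<mu> n) = norm_moment \<mu> s n (mat 1)"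
  unfolding conv_measure_def norm_moment_def
  by (subst nn_integral_distr) (auto intro: measurable_mat_prod[OF sets_\<mu>])

lemma measurable_powr_sandwich:
  fixes X Y :: "real ^ 'd ^ 'd"
  shows "(\<lambda>y. ennreal (op_norm (X ** y ** Y) powr s)) \<in> borel_measurable \<mu>"
  unfolding measurable_cong_sets[OF sets_\<mu> refl] by measurable

lemma norm_moment_0: "norm_moment \<mu> s 0 Y = ennreal (op_norm Y powr s)"
  unfolding norm_moment_def by (simp add: PiM_empty nn_integral_count_space_finite)

lemma norm_moment_Suc:
  "norm_moment \<mu> s (Suc n) Y = (\<integral>\<^sup>+ y. norm_moment \<mu> s n (y ** Y) \<partial>\<mu>)"
proof -
  interpret finite_measure \<mu> by (rule fin_\<mu>)
  interpret product_sigma_finite "\<lambda>_::nat. \<mu>" ..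
  have upd: "mat_prod n (A(n := y)) = mat_prod n A" for A y
    by (rule mat_prod_cong) simp
  have meas: "(\<lambda>A. ennreal (op_norm (mat_prod (Suc n) A ** Y) powr s))
      \<in> borel_measurable (\<Pi>\<^sub>M i\<in>insert n {..<n}. \<mu>)"
    using measurable_mat_prod[OF sets_\<mu>, of "Suc n" "insert n {..<n}"]
    by (simp add: lessThan_Suc del: mat_prod.simps)
  have "norm_moment \<mu> s (Suc n) Y
      = (\<integral>\<^sup>+ y. \<integral>\<^sup>+ A. ennreal (op_norm (mat_prod (Suc n) (A(n := y)) ** Y) powr s)
          \<partial>(\<Pi>\<^sub>M i\<in>{..<n}. \<mu>) \<partial>\<mu>)"
    unfolding norm_moment_def lessThan_Suc
    by (rule product_nn_integral_insert_rev[OF _ _ meas]) auto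
  then show ?thesis
    unfolding norm_moment_def by (simp add: upd matrix_mul_assoc)
qed

lemma measurable_norm_moment: "norm_moment \<mu> s n \<in> borel_measurable borel"
proof (induction n)
  case 0
  then show ?case by (simp add: norm_moment_0 cong: measurable_cong)
next
  case (Suc n)
  interpret finite_measure \<mu> by (rule fin_\<mu>)
  note [measurable] = Suc
  have [measurable_cong]: "sets \<mu> = sets borel" by (rule sets_\<mu>)
  show ?case
    unfolding norm_moment_Suc[abs_def] by measurable
qed

text \<open>
  Almost every factor lies in the support \<open>K\<close>, so a bound valid for factors from \<open>K\<close> may be
  integrated against the product measure, whose total mass is the \<open>n\<close>-th power of that of \<open>\<mu>\<close>.
\<close>
lemma norm_moment_upper:
  assumes supp: "measure_supp \<mu> = K" and s: "s > 0"
    and c: "\<And>A. (\<And>i. i < n \<Longrightarrow> A i \<in> K) \<Longrightarrow> op_norm (mat_prod n A ** Y) \<le> c"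
  shows "norm_moment \<mu> s n Y \<le> ennreal (c powr s) * emeasure \<mu> (space \<mu>) ^ n"
  using c
proof (induction n arbitrary: Y)
  case 0
  show ?case
    using 0 s by (auto simp: norm_moment_0 op_norm_nonneg intro!: ennreal_leI powr_mono2)
next
  case (Suc n)
  have "norm_moment \<mu> s (Suc n) Y
      \<le> (\<integral>\<^sup>+ y. ennreal (c powr s) * emeasure \<mu> (space \<mu>) ^ n \<partial>\<mu>)"
    unfolding norm_moment_Suc
  proof (rule nn_integral_mono_AE)
    show "AE y in \<mu>. norm_moment \<mu> s n (y ** Y) \<le> ennreal (c powr s) * emeasure \<mu> (space \<mu>) ^ n"
      using AE_in_measure_supp[OF sets_\<mu>]
    proof eventually_elim
      case (elim y)
      show ?case
      proof (rule Suc.IH)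
        fix A :: "nat \<Rightarrow> real ^ 'd ^ 'd" assume A: "\<And>i. i < n \<Longrightarrow> A i \<in> K"
        have "op_norm (mat_prod (Suc n) (A(n := y)) ** Y) \<le> c"
          using A elim supp by (intro Suc.prems) (auto simp: less_Suc_eq)
        moreover have "mat_prod n (A(n := y)) = mat_prod n A"
          by (rule mat_prod_cong) simp
        ultimately show "op_norm (mat_prod n A ** (y ** Y)) \<le> c"
          by (simp add: matrix_mul_assoc)
      qed
    qed
  qed
  also have "\<dots> = ennreal (c powr s) * emeasure \<mu> (space \<mu>) ^ Suc n"
    by (simp add: mult_ac)
  finally show ?case .
qed

text \<open>
  The factors \<open>A i\<close> are replaced by integration variables one at a time, starting from the right;
  each replacement costs the factor \<open>\<kappa>\<close> of the hypothesis, applied to the seminorm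
  \<open>B \<mapsto> \<parallel>A\<^sub>1 \<dots> A\<^sub>n B Y\<parallel>\<close>. Hence the loss is only exponential in \<open>n\<close>, with a rate that does not depend on
  the matrices.
\<close>
lemma norm_moment_lower:
  assumes one_step: "\<And>p A. seminorm p \<Longrightarrow> A \<in> K \<Longrightarrow>
       \<kappa> * ennreal (p A powr s) \<le> (\<integral>\<^sup>+B. ennreal (p B powr s) \<partial>\<mu>)"
    and A: "\<And>i. i < n \<Longrightarrow> A i \<in> K"
  shows "\<kappa> ^ n * ennreal (op_norm (mat_prod n A ** Y) powr s) \<le> norm_moment \<mu> s n Y"
  using A
proof (induction n arbitrary: Y)
  case 0
  show ?case by (simp add: norm_moment_0)
next
  case (Suc n)
  have "\<kappa> ^ Suc n * ennreal (op_norm (mat_prod (Suc n) A ** Y) powr s)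
      = \<kappa> ^ n * (\<kappa> * ennreal (op_norm (mat_prod n A ** A n ** Y) powr s))"
    by (simp add: mult_ac)
  also have "\<dots> \<le> \<kappa> ^ n * (\<integral>\<^sup>+ y. ennreal (op_norm (mat_prod n A ** y ** Y) powr s) \<partial>\<mu>)"
    by (intro mult_left_mono one_step[OF seminorm_op_norm_sandwich] Suc.prems) auto
  also have "\<dots> = (\<integral>\<^sup>+ y. \<kappa> ^ n * ennreal (op_norm (mat_prod n A ** y ** Y) powr s) \<partial>\<mu>)"
    by (rule nn_integral_cmult[symmetric, OF measurable_powr_sandwich])
  also have "\<dots> \<le> (\<integral>\<^sup>+ y. norm_moment \<mu> s n (y ** Y) \<partial>\<mu>)"
    using Suc.IH[OF Suc.prems] by (intro nn_integral_mono) (simp add: matrix_mul_assoc[symmetric])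
  also have "\<dots> = norm_moment \<mu> s (Suc n) Y"
    by (rule norm_moment_Suc[symmetric])
  finally show ?case .
qed

lemma norm_moment_submultiplicative:
  assumes s: "s > 0"
  shows "norm_moment \<mu> s (m + n) Y \<le> norm_moment \<mu> s m (mat 1) * norm_moment \<mu> s n Y"
proof (induction n arbitrary: Y)
  case 0
  have "norm_moment \<mu> s m Y
      \<le> (\<integral>\<^sup>+ A. ennreal (op_norm (mat_prod m A) powr s) * ennreal (op_norm Y powr s)
          \<partial>(\<Pi>\<^sub>M i\<in>{..<m}. \<mu>))"
    unfolding norm_moment_def
  proof (rule nn_integral_mono)
    fix A
    have "op_norm (mat_prod m A ** Y) powr s \<le> (op_norm (mat_prod m A) * op_norm Y) powr s"
      using s by (intro powr_mono2 op_norm_mult op_norm_nonneg) auto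
    then show "ennreal (op_norm (mat_prod m A ** Y) powr s)
        \<le> ennreal (op_norm (mat_prod m A) powr s) * ennreal (op_norm Y powr s)"
      by (simp add: powr_mult op_norm_nonneg ennreal_mult[symmetric] ennreal_leI)
  qed
  also have "\<dots> = norm_moment \<mu> s m (mat 1) * ennreal (op_norm Y powr s)"
    unfolding norm_moment_def
    using measurable_mat_prod[OF sets_\<mu>, of m "{..<m}"]
    by (simp add: nn_integral_multc)
  finally show ?case by (simp add: norm_moment_0)
next
  case (Suc n)
  have meas: "(\<lambda>y. norm_moment \<mu> s n (y ** Y)) \<in> borel_measurable \<mu>"
    using measurable_norm_moment unfolding measurable_cong_sets[OF sets_\<mu> refl] by measurable
  have "norm_moment \<mu> s (m + Suc n) Y = (\<integral>\<^sup>+ y. norm_moment \<mu> s (m + n) (y ** Y) \<partial>\<mu>)"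
    by (simp add: norm_moment_Suc)
  also have "\<dots> \<le> (\<integral>\<^sup>+ y. norm_moment \<mu> s m (mat 1) * norm_moment \<mu> s n (y ** Y) \<partial>\<mu>)"
    by (intro nn_integral_mono Suc)
  also have "\<dots> = norm_moment \<mu> s m (mat 1) * norm_moment \<mu> s (Suc n) Y"
    by (simp add: nn_integral_cmult[OF meas] norm_moment_Suc)
  finally show ?case .
qed

end

section \<open>The norm pressure as a growth rate\<close>

lemma ext_ln_tendsto:
  assumes x: "x \<longlonglongrightarrow> l" and nonneg: "\<And>n. 0 \<le> x n"
  shows "(\<lambda>n. ext_ln (ennreal (x n))) \<longlonglongrightarrow> ext_ln (ennreal l)"
proof -
  have l: "0 \<le> l"
    using x nonneg by (intro LIMSEQ_le_const) auto
  show ?thesis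
  proof (cases "l = 0")
    case True
    have "\<forall>\<^sub>F n in sequentially. ext_ln (ennreal (x n)) < ereal r" for r
    proof -
      have "\<forall>\<^sub>F n in sequentially. x n < exp r"
        using x True by (intro order_tendstoD) auto
      then show ?thesis
      proof eventually_elim
        case (elim n)
        show ?case
        proof (cases "x n = 0")
          case False
          then have "0 < x n" using nonneg[of n] by simp
          then have "ln (x n) < r"
            using elim by (metis exp_gt_zero ln_exp ln_less_cancel_iff)
          then show ?thesis
            using False nonneg[of n] by (simp add: ext_ln_def)
        qed (simp add: ext_ln_def)
      qed
    qed
    then show ?thesis
      using True by (simp add: ext_ln_def tendsto_MInfty)
  next
    case False
    then have "0 < l" using l by simp
    then have "(\<lambda>n. ereal (ln (x n))) \<longlonglongrightarrow> ereal (ln l)"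
      using x by (intro tendsto_intros) auto
    moreover have "\<forall>\<^sub>F n in sequentially. ereal (ln (x n)) = ext_ln (ennreal (x n))"
      using order_tendstoD(1)[OF x \<open>0 < l\<close>]
      by eventually_elim (simp add: ext_ln_def)
    moreover have "ext_ln (ennreal l) = ereal (ln l)"
      using \<open>0 < l\<close> by (simp add: ext_ln_def)
    ultimately show ?thesis
      using Lim_transform_eventually by fastforce
  qed
qed

lemma ext_ln_root:
  assumes "n > 0" "0 \<le> a"
  shows "ereal (1 / real n) * ext_ln (ennreal a) = ext_ln (ennreal (root n a))"
proof (cases "a = 0")
  case False
  then have "0 < a" using assms by simp
  then show ?thesis
    using assms by (simp add: ext_ln_def ln_root)
qed (use assms in \<open>simp add: ext_ln_def\<close>)

lemma ext_exp_ext_ln_divide: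
  assumes "0 \<le> x" "s > 0"
  shows "ext_exp (ext_ln (ennreal x) / ereal s) = ereal (x powr (1 / s))"
proof (cases "x = 0")
  case True
  have "ext_exp (-\<infinity>) = 0"
    using ext_exp.simps(3) by (simp only: MInfty_eq_minfinity)
  then show ?thesis
    using True assms by (simp add: ext_ln_def)
next
  case False
  then show ?thesis
    using assms by (simp add: ext_ln_def powr_def)
qed

text \<open>
  Passing to \<open>n\<close>-th roots before taking logarithms keeps the limit among the nonnegative reals, so
  that the pressure \<open>-\<infinity>\<close> is simply the case \<open>I = 0\<close>. This also shows that the limit defining the
  pressure exists.
\<close>
lemma norm_pressure_eq_ext_ln_growth_rate:
  fixes \<mu> :: "(real ^ 'd ^ 'd) measure"
  assumes sets: "sets \<mu> = sets borel" and fin: "finite_measure \<mu>"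
    and s: "s > 0" and finite_moment: "\<And>n. norm_moment \<mu> s n (mat 1) < \<infinity>"
  obtains I where "I \<ge> 0" "(\<lambda>n. root n (enn2real (norm_moment \<mu> s n (mat 1)))) \<longlonglongrightarrow> I"
    "norm_pressure \<mu> s = ext_ln (ennreal I)"
proof -
  define a where "a n = enn2real (norm_moment \<mu> s n (mat 1))" for n
  have a0: "0 \<le> a n" for n by (simp add: a_def)
  have moment: "norm_moment \<mu> s n (mat 1) = ennreal (a n)" for n
    unfolding a_def using finite_moment[of n] by (simp add: less_top)
  have "a (m + n) \<le> a m * a n" for m n
    using norm_moment_submultiplicative[OF sets fin s, of m n "mat 1"]
    by (simp add: moment a0 ennreal_mult[symmetric])
  then obtain I where I: "I \<ge> 0" "(\<lambda>n. root n (a n)) \<longlonglongrightarrow> I"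
    using submultiplicative_root_convergent[of a] a0 by blast
  have "(\<lambda>n. ext_ln (ennreal (root n (a n)))) \<longlonglongrightarrow> ext_ln (ennreal I)"
    by (rule ext_ln_tendsto[OF I(2)]) (metis a0 real_root_ge_zero)
  then have "(\<lambda>n. ereal (1 / real n) * ext_ln (ennreal (a n))) \<longlonglongrightarrow> ext_ln (ennreal I)"
    by (rule Lim_transform_eventually)
       (use eventually_gt_at_top[of 0] in eventually_elim, simp add: ext_ln_root a0)
  then have "norm_pressure \<mu> s = ext_ln (ennreal I)"
    unfolding norm_pressure_def nn_integral_conv_measure[OF sets fin] moment by (rule limI)
  then show thesis
    using that I unfolding a_def by blast
qed

section \<open>The limit of large exponents\<close>

text \<open>
  The two comparisons between \<open>N\<^sub>n(s)\<close> and \<open>R\<^sub>n\<^sup>s\<close>, with an exponential factor \<open>k\<^sup>n\<close>, pass to the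
  growth rates.
\<close>
lemma root_growth_bounds:
  fixes a b :: "nat \<Rightarrow> real"
  assumes "\<And>n. 0 \<le> a n" "\<And>n. 0 \<le> b n" "0 \<le> k" "s > 0"
    and a: "(\<lambda>n. root n (a n)) \<longlonglongrightarrow> \<alpha>" and b: "(\<lambda>n. root n (b n)) \<longlonglongrightarrow> \<beta>"
  shows "(\<And>n. a n \<le> k ^ n * b n powr s) \<Longrightarrow> \<alpha> \<le> k * \<beta> powr s"
    and "(\<And>n. k ^ n * b n powr s \<le> a n) \<Longrightarrow> k * \<beta> powr s \<le> \<alpha>"
proof -
  have root_b: "root n (k ^ n * b n powr s) = k * root n (b n) powr s" if "n > 0" for n
  proof -
    have "root n (b n powr s) = root n (b n) powr s"
    proof (cases "b n = 0")
      case False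
      then have "0 < b n" using assms(2)[of n] by simp
      then show ?thesis
        using that by (simp add: root_powr_inverse powr_powr mult.commute)
    qed (use that in simp)
    then show ?thesis
      using that \<open>0 \<le> k\<close> by (simp add: real_root_mult real_root_power_cancel)
  qed
  have lim: "(\<lambda>n. k * root n (b n) powr s) \<longlonglongrightarrow> k * \<beta> powr s"
    using b \<open>s > 0\<close> assms(2)
    by (intro tendsto_intros tendsto_powr') (auto intro!: always_eventually real_root_ge_zero)
  show "\<alpha> \<le> k * \<beta> powr s" if "\<And>n. a n \<le> k ^ n * b n powr s"
  proof (rule LIMSEQ_le[OF a lim], intro exI[of _ 1] allI impI)
    fix n :: nat assume "1 \<le> n"
    then show "root n (a n) \<le> k * root n (b n) powr s"
      using that[of n] root_b[of n] by (metis less_le_trans real_root_le_iff zero_less_one)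
  qed
  show "k * \<beta> powr s \<le> \<alpha>" if "\<And>n. k ^ n * b n powr s \<le> a n"
  proof (rule LIMSEQ_le[OF lim a], intro exI[of _ 1] allI impI)
    fix n :: nat assume "1 \<le> n"
    then show "k * root n (b n) powr s \<le> root n (a n)"
      using that[of n] root_b[of n] by (metis less_le_trans real_root_le_iff zero_less_one)
  qed
qed

lemma const_powr_inverse_tendsto_1:
  fixes c :: real
  assumes "c > 0"
  shows "((\<lambda>s. c powr (1 / s)) \<longlongrightarrow> 1) at_top"
proof -
  have "((\<lambda>s::real. 1 / s) \<longlongrightarrow> 0) at_top"
    by (intro tendsto_divide_0[OF tendsto_const] filterlim_at_top_imp_at_infinity filterlim_ident)
  then have "((\<lambda>s. c powr (1 / s)) \<longlongrightarrow> c powr 0) at_top"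
    using assms by (intro tendsto_intros) auto
  then show ?thesis using assms by simp
qed

theorem theorem2p8:
  fixes K :: "(real ^ 'd ^ 'd) set" and \<mu> :: "(real ^ 'd ^ 'd) measure"
  assumes "K \<noteq> {}" and "compact K"
    and "sets \<mu> = sets borel" and "finite_measure \<mu>"
    and "measure_supp \<mu> = K"
  shows "((\<lambda>s::real. ext_exp (norm_pressure \<mu> s / ereal s))
           \<longlongrightarrow> ereal (joint_spectral_radius K)) at_top"
proof -
  note K = assms(1,2) and sets = assms(3) and fin = assms(4) and supp = assms(5)
  interpret finite_measure \<mu> by (rule fin)
  define \<rho> where "\<rho> = joint_spectral_radius K"
  define R where "R = max_prod_norm K"
  define m where "m = measure \<mu> (space \<mu>)"
  define a where "a s n = enn2real (norm_moment \<mu> s n (mat 1))" for s n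
  have \<rho>0: "0 \<le> \<rho>" and R0: "\<And>n. 0 \<le> R n" and R: "(\<lambda>n. root n (R n)) \<longlonglongrightarrow> \<rho>"
    unfolding \<rho>_def R_def
    using joint_spectral_radius_nonneg[OF K] max_prod_norm_nonneg[OF K]
      max_prod_norm_root_tendsto[OF K] by auto
  have m0: "0 < m"
  proof -
    obtain A where "A \<in> K" using K by blast
    then have "0 < emeasure \<mu> UNIV"
      using supp unfolding measure_supp_def by auto
    then show ?thesis
      using sets_eq_imp_space_eq[OF sets]
      by (simp add: m_def emeasure_eq_measure ennreal_less_zero_iff)
  qed
  have upper: "norm_moment \<mu> s n (mat 1) \<le> ennreal (m ^ n * R n powr s)" if s: "s > 0" for s n
  proof -
    have "norm_moment \<mu> s n (mat 1) \<le> ennreal (R n powr s) * emeasure \<mu> (space \<mu>) ^ n"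
      using op_norm_mat_prod_le_max[OF K]
      by (intro norm_moment_upper[OF sets fin supp s]) (simp add: R_def)
    also have "\<dots> = ennreal (m ^ n * R n powr s)"
      using m0 by (simp add: emeasure_eq_measure m_def ennreal_power ennreal_mult[symmetric] mult.commute)
    finally show ?thesis .
  qed
  have moment: "norm_moment \<mu> s n (mat 1) = ennreal (a s n)" if "s > 0" for s n
    unfolding a_def using le_less_trans[OF upper[OF that, of n] ennreal_less_top] by simp
  have "\<exists>I\<ge>0. (\<lambda>n. root n (a s n)) \<longlonglongrightarrow> I \<and> norm_pressure \<mu> s = ext_ln (ennreal I)"
    if s: "s > 0" for s
    using norm_pressure_eq_ext_ln_growth_rate[OF sets fin s] moment[OF s]
    unfolding a_def by (metis ennreal_less_top infinity_ennreal_def)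
  then obtain I where I0: "\<And>s. s > 0 \<Longrightarrow> 0 \<le> I s"
    and I: "\<And>s. s > 0 \<Longrightarrow> (\<lambda>n. root n (a s n)) \<longlonglongrightarrow> I s"
    and pressure: "\<And>s. s > 0 \<Longrightarrow> norm_pressure \<mu> s = ext_ln (ennreal (I s))"
    by metis
  have a0: "0 \<le> a s n" for s n by (simp add: a_def)
  have root_bound: "(k * x powr s) powr (1 / s) = k powr (1 / s) * x"
    if "s > 0" "0 \<le> x" "0 \<le> k" for k x s :: real
    using that by (simp add: powr_mult powr_powr)

  \<comment> \<open>Bounding each factor by the support, with total mass \<open>m\<close> per factor.\<close>
  have I_upper: "I s powr (1 / s) \<le> m powr (1 / s) * \<rho>" if s: "s > 0" for s
  proof -
    have "I s \<le> m * \<rho> powr s"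
    proof (rule root_growth_bounds(1)[OF a0 R0 _ s I[OF s] R])
      show "a s n \<le> m ^ n * R n powr s" for n
        using upper[OF s, of n] m0 by (simp add: moment[OF s])
    qed (use m0 in simp)
    then have "I s powr (1 / s) \<le> (m * \<rho> powr s) powr (1 / s)"
      using s I0 by (intro powr_mono2) auto
    then show ?thesis
      using s \<rho>0 m0 by (simp add: root_bound)
  qed

  \<comment> \<open>It is essential that \<open>c\<close> is chosen before \<open>s\<close>, as its \<open>s\<close>-th root must tend to 1.\<close>
  have I_lower: "\<exists>c>0. \<forall>s>0. c powr (1 / s) * ((1 - \<delta>) * \<rho>) \<le> I s powr (1 / s)"
    if \<delta>: "0 < \<delta>" "\<delta> < 1" for \<delta>
  proof -
    obtain c where c: "c > 0"
      "\<And>p s A. seminorm p \<Longrightarrow> s > 0 \<Longrightarrow> A \<in> K \<Longrightarrow>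
         ennreal (c * (1 - \<delta>) powr s) * ennreal (p A powr s) \<le> (\<integral>\<^sup>+B. ennreal (p B powr s) \<partial>\<mu>)"
      using seminorm_integral_lower_bound[OF sets fin supp K(2) \<delta>] by metis
    have "c powr (1 / s) * ((1 - \<delta>) * \<rho>) \<le> I s powr (1 / s)" if s: "s > 0" for s
    proof -
      define \<kappa> where "\<kappa> = c * (1 - \<delta>) powr s"
      have \<kappa>: "0 < \<kappa>" using c(1) \<delta> by (simp add: \<kappa>_def)
      have "\<kappa> * \<rho> powr s \<le> I s"
      proof (rule root_growth_bounds(2)[OF a0 R0 _ s I[OF s] R])
        fix n
        have le: "op_norm (mat_prod n A) \<le> (a s n / \<kappa> ^ n) powr (1 / s)"
          if A: "\<And>i. i < n \<Longrightarrow> A i \<in> K" for A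
        proof -
          have "ennreal \<kappa> ^ n * ennreal (op_norm (mat_prod n A ** mat 1) powr s)
              \<le> norm_moment \<mu> s n (mat 1)"
            unfolding \<kappa>_def by (rule norm_moment_lower[OF sets fin c(2)[OF _ s] A])
          then have "\<kappa> ^ n * op_norm (mat_prod n A) powr s \<le> a s n"
            using \<kappa> a0 by (simp add: moment[OF s] ennreal_power ennreal_mult[symmetric])
          then have "op_norm (mat_prod n A) powr s \<le> a s n / \<kappa> ^ n"
            using \<kappa> by (simp add: field_simps)
          then have "(op_norm (mat_prod n A) powr s) powr (1 / s) \<le> (a s n / \<kappa> ^ n) powr (1 / s)"
            using s by (intro powr_mono2) auto
          then show ?thesis
            using s by (simp add: powr_powr op_norm_nonneg)
        qed
        have "R n powr s \<le> ((a s n / \<kappa> ^ n) powr (1 / s)) powr s"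
          using s R0 unfolding R_def
          by (intro powr_mono2 max_prod_norm_le[OF K] le) auto
        also have "\<dots> = a s n / \<kappa> ^ n"
          using s \<kappa> a0 by (simp add: powr_powr)
        finally show "\<kappa> ^ n * R n powr s \<le> a s n"
          using \<kappa> by (simp add: field_simps)
      qed (use \<kappa> in simp)
      then have "c * ((1 - \<delta>) * \<rho>) powr s \<le> I s"
        using \<delta> \<rho>0 by (simp add: \<kappa>_def powr_mult mult.assoc)
      then have "(c * ((1 - \<delta>) * \<rho>) powr s) powr (1 / s) \<le> I s powr (1 / s)"
        using s c(1) by (intro powr_mono2) auto
      then show ?thesis
        using s \<rho>0 \<delta> c(1) by (simp add: root_bound)
    qed
    then show ?thesis using c(1) by blast
  qed

  have "((\<lambda>s. I s powr (1 / s)) \<longlongrightarrow> \<rho>) at_top"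
  proof (rule order_tendstoI)
    fix b assume b: "\<rho> < b"
    have "((\<lambda>s. m powr (1 / s) * \<rho>) \<longlongrightarrow> 1 * \<rho>) at_top"
      by (intro tendsto_intros const_powr_inverse_tendsto_1 m0)
    then have "\<forall>\<^sub>F s in at_top. m powr (1 / s) * \<rho> < b"
      using b by (intro order_tendstoD) auto
    then show "\<forall>\<^sub>F s in at_top. I s powr (1 / s) < b"
      using eventually_gt_at_top[of 0]
    proof eventually_elim
      case (elim s)
      then show ?case using I_upper[of s] by simp
    qed
  next
    fix b assume b: "b < \<rho>"
    have "((\<lambda>\<delta>. (1 - \<delta>) * \<rho>) \<longlongrightarrow> (1 - 0) * \<rho>) (at_right 0)"
      by (intro tendsto_intros)
    then have "\<forall>\<^sub>F \<delta> in at_right 0. b < (1 - \<delta>) * \<rho>"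
      using b by (intro order_tendstoD) auto
    moreover have "\<forall>\<^sub>F \<delta> in at_right (0::real). 0 < \<delta> \<and> \<delta> < 1"
      using eventually_at_right_real[of 0 "1::real"] by simp
    ultimately have "\<forall>\<^sub>F \<delta> in at_right 0. b < (1 - \<delta>) * \<rho> \<and> 0 < \<delta> \<and> \<delta> < 1"
      by eventually_elim simp
    then obtain \<delta> where \<delta>: "b < (1 - \<delta>) * \<rho>" "0 < \<delta>" "\<delta> < 1"
      using eventually_happens'[OF trivial_limit_at_right_real] by blast
    obtain c where c: "c > 0"
      "\<And>s. s > 0 \<Longrightarrow> c powr (1 / s) * ((1 - \<delta>) * \<rho>) \<le> I s powr (1 / s)"
      using I_lower[OF \<delta>(2,3)] by blast
    have "((\<lambda>s. c powr (1 / s) * ((1 - \<delta>) * \<rho>)) \<longlongrightarrow> 1 * ((1 - \<delta>) * \<rho>)) at_top"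
      by (intro tendsto_intros const_powr_inverse_tendsto_1 c(1))
    then have "\<forall>\<^sub>F s in at_top. b < c powr (1 / s) * ((1 - \<delta>) * \<rho>)"
      using \<delta>(1) by (intro order_tendstoD) auto
    then show "\<forall>\<^sub>F s in at_top. b < I s powr (1 / s)"
      using eventually_gt_at_top[of 0]
    proof eventually_elim
      case (elim s)
      then show ?case using c(2)[of s] by simp
    qed
  qed
  then have "((\<lambda>s. ereal (I s powr (1 / s))) \<longlongrightarrow> ereal \<rho>) at_top"
    by (rule tendsto_ereal)
  then show ?thesis
    unfolding \<rho>_def[symmetric]
    by (rule Lim_transform_eventually)
       (use eventually_gt_at_top[of 0] in eventually_elim, simp add: pressure ext_exp_ext_ln_divide I0)
qed

end
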